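(* Let $X$ be a poset and $K$ a field with $|K|>2$. Let $\lambda$ be a $|K|$-complete endomorphism of the Boolean algebra $\mathcal{P}(X)$, let $\psi:FI(X,K)\to J(FI(X,K))$ be a linear map with $\psi(\delta)=0$, and let $\varphi:FI(X,K)\to FI(X,K)$ be the unital linear invertibility preserver given by $$\varphi(\alpha)=\sum_{k\in K}k\,e_{\lambda(L_k(\alpha))}+\psi(\alpha).$$ Then $\varphi$ is surjective and strong if and only if both of the following hold: (1) $\lambda$ is an automorphism of the Boolean algebra $\mathcal{P}(X)$; (2) $\psi(J(FI(X,K)))=J(FI(X,K))$.
   Context: The finitary incidence algebra $FI(X,K)$ of a poset $(X,\le)$ over a field $K$ is the $K$-space of formal sums $\alpha=\sum_{x\le y}\alpha_{xy}e_{xy}$ ($x,y\in X$, $\alpha_{xy}\in K$, $e_{xy}$ symbols) such that for all $x<y$ the set of pairs $(u,v)$ with $x\le u<v\le y$ and $\alpha_{uv}\neq 0$ is finite. The product is $\alpha\beta=\sum_{x\le y}\big(\sum_{x\le z\le y}\alpha_{xz}\beta_{zy}\big)e_{xy}$; it is a unital associative algebra with identity $\delta=\sum_{x\in X}e_{xx}$. Write $e_x=e_{xx}$ and, for $A\subseteq X$, $e_A=\sum_{x\in A}e_x$. Put $J(FI(X,K))=\{\alpha\in FI(X,K)\mid \alpha_{xx}=0\ \forall x\in X\}$ (this is the Jacobson radical). For $k\in K$, $L_k(\alpha)=\{x\in X\mid \alpha_{xx}=k\}$. For pairwise disjoint sets $B_k\subseteq X$ ($k\in K$), $\sum_{k\in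 K}k\,e_{B_k}$ denotes the element with zero off-diagonal coefficients whose $(x,x)$-coefficient is $k$ if $x\in B_k$ and $0$ if $x$ lies in no $B_k$. A map $\varphi:A\to A$ on a unital associative algebra $A$ is an invertibility preserver of $A$ if $\varphi(U(A))\subseteq U(A)$, where $U(A)$ is the group of units; it is unital if $\varphi(1_A)=1_A$. An invertibility preserver $\varphi$ of $A$ is strong if for all $a\in A$: $a\in U(A)\iff\varphi(a)\in U(A)$. Linear means $K$-linear. $\mathcal{P}(X)$ is the Boolean algebra of all subsets of $X$ under union, intersection and complement; endomorphisms of Boolean algebras preserve these operations and also $0=\emptyset$ and $1=X$. For a cardinal $\kappa$, an endomorphism $\lambda$ of $\mathcal{P}(X)$ is $\kappa$-complete if $\lambda(\bigcup_{i\in I}A_i)=\bigcup_{i\in I}\lambda(A_i)$ for every family $\{A_i\}_{i\in I}$ of subsets of $X$ with $|I|\le\kappa$. *)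

theory Defs
  imports Complex_Main
begin

section \<open>The finitary incidence algebra\<close>

text \<open>The poset \<open>X\<close> is the universe of a type \<open>'a\<close> of class \<^class>\<open>order\<close>. A formal sum
  \<open>\<Sum>\<^bsub>x \<le> y\<^esub> \<alpha>\<^bsub>xy\<^esub> e\<^bsub>xy\<^esub>\<close> is represented by its coefficient function, extended by \<open>0\<close>
  to the pairs with \<open>\<not> x \<le> y\<close>.\<close>

typedef (overloaded) ('a::order, 'k::field) fi =
  "{\<alpha> :: 'a \<Rightarrow> 'a \<Rightarrow> 'k.
      (\<forall>x y. \<not> x \<le> y \<longrightarrow> \<alpha> x y = 0) \<and>
      (\<forall>x y. x < y \<longrightarrow> finite {(u, v). x \<le> u \<and> u < v \<and> v \<le> y \<and> \<alpha> u v \<noteq> 0})}"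
  morphisms coeff Abs_fi
  by (rule exI[of _ "\<lambda>_ _. 0"]) simp

setup_lifting type_definition_fi

lemma fi_eqI: "(\<And>x y. coeff \<alpha> x y = coeff \<beta> x y) \<Longrightarrow> \<alpha> = \<beta>"
  by (metis coeff_inject ext)

lemma coeff_eq_0: "\<not> x \<le> y \<Longrightarrow> coeff \<alpha> x y = 0"
  using coeff[of \<alpha>] by simp

text \<open>All off-diagonal support of \<open>\<alpha>\<close> inside \<open>[x, y]\<close> has its end points in a finite set.\<close>

definition endpoints :: "'a::order \<Rightarrow> 'a \<Rightarrow> ('a \<Rightarrow> 'a \<Rightarrow> 'k::zero) \<Rightarrow> 'a set" where
  "endpoints x y \<alpha> =
     {x, y} \<union> fst ` {(u, v). x \<le> u \<and> u < v \<and> v \<le> y \<and> \<alpha> u v \<noteq> 0}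
            \<union> snd ` {(u, v). x \<le> u \<and> u < v \<and> v \<le> y \<and> \<alpha> u v \<noteq> 0}"

lemma endpoints_mem:
  assumes "x \<le> u" "u < v" "v \<le> y" "\<alpha> u v \<noteq> 0"
  shows "u \<in> endpoints x y \<alpha>" "v \<in> endpoints x y \<alpha>"
  using assms unfolding endpoints_def by force+

lemma finite_endpoints:
  assumes "\<And>x y. x < y \<Longrightarrow> finite {(u, v). x \<le> u \<and> u < v \<and> v \<le> y \<and> \<alpha> u v \<noteq> 0}"
  shows "finite (endpoints x y \<alpha>)"
proof (cases "x < y")
  case False
  then have "{(u, v). x \<le> u \<and> u < v \<and> v \<le> y \<and> \<alpha> u v \<noteq> 0} = {}"
    by (auto dest: order.strict_trans1 order.strict_trans2)
  then show ?thesis unfolding endpoints_def by (simp only:) simp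
qed (simp add: endpoints_def assms)

lemma finite_endpoints_coeff: "finite (endpoints x y (coeff \<alpha>))"
  using coeff[of \<alpha>] by (intro finite_endpoints) simp

text \<open>The inner sum of the product runs over those \<open>z\<close> with a nonzero summand; these are
  finitely many, and they all lie in \<open>[x, y]\<close>.\<close>

definition conv :: "('a::order \<Rightarrow> 'a \<Rightarrow> 'k::field) \<Rightarrow> ('a \<Rightarrow> 'a \<Rightarrow> 'k) \<Rightarrow> 'a \<Rightarrow> 'a \<Rightarrow> 'k" where
  "conv \<alpha> \<beta> x y = (\<Sum>z | x \<le> z \<and> z \<le> y \<and> \<alpha> x z * \<beta> z y \<noteq> 0. \<alpha> x z * \<beta> z y)"

lemma conv_eq_sum:
  assumes "\<And>x y. \<not> x \<le> y \<Longrightarrow> \<alpha> x y = 0" "\<And>x y. \<not> x \<le> y \<Longrightarrow> \<beta> x y = 0"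
    and "finite F" "\<And>z. \<lbrakk>x \<le> z; z \<le> y; \<alpha> x z \<noteq> 0; \<beta> z y \<noteq> 0\<rbrakk> \<Longrightarrow> z \<in> F"
  shows "conv \<alpha> \<beta> x y = (\<Sum>z\<in>F. \<alpha> x z * \<beta> z y)"
  unfolding conv_def
proof (rule sum.mono_neutral_left)
  show "\<forall>z\<in>F - {z. x \<le> z \<and> z \<le> y \<and> \<alpha> x z * \<beta> z y \<noteq> 0}. \<alpha> x z * \<beta> z y = 0"
    using assms(1,2) by fastforce
qed (use assms in auto)

lemma conv_nonzeroE:
  assumes "conv \<alpha> \<beta> x y \<noteq> 0"
  obtains z where "x \<le> z" "z \<le> y" "\<alpha> x z \<noteq> 0" "\<beta> z y \<noteq> 0"
proof -
  from assms obtain z where "z \<in> {z. x \<le> z \<and> z \<le> y \<and> \<alpha> x z * \<beta> z y \<noteq> 0}"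
    unfolding conv_def by (metis (no_types, lifting) sum.not_neutral_contains_not_neutral)
  then show thesis using that by auto
qed

instantiation fi :: (order, field) ring_1
begin

lift_definition zero_fi :: "('a, 'b) fi" is "\<lambda>_ _. 0" by simp

lift_definition one_fi :: "('a, 'b) fi" is "\<lambda>x y. if x = y then 1 else 0"
proof -
  have "{(u, v). x \<le> u \<and> u < v \<and> v \<le> y \<and> (if u = v then 1 else 0) \<noteq> (0::'b)} = {}" for x y :: 'a
    by auto
  then show "(\<forall>x y::'a. \<not> x \<le> y \<longrightarrow> (if x = y then 1 else 0) = (0::'b)) \<and>
    (\<forall>x y::'a. x < y \<longrightarrow> finite {(u, v). x \<le> u \<and> u < v \<and> v \<le> y \<and> (if u = v then 1 else 0) \<noteq> (0::'b)})"
    by auto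
qed

lift_definition uminus_fi :: "('a, 'b) fi \<Rightarrow> ('a, 'b) fi" is "\<lambda>\<alpha> x y. - \<alpha> x y" by simp

lift_definition plus_fi :: "('a, 'b) fi \<Rightarrow> ('a, 'b) fi \<Rightarrow> ('a, 'b) fi"
  is "\<lambda>\<alpha> \<beta> x y. \<alpha> x y + \<beta> x y"
proof (intro conjI allI impI)
  fix \<alpha> \<beta> :: "'a \<Rightarrow> 'a \<Rightarrow> 'b" and x y :: 'a
  assume a: "(\<forall>x y. \<not> x \<le> y \<longrightarrow> \<alpha> x y = 0) \<and>
      (\<forall>x y. x < y \<longrightarrow> finite {(u, v). x \<le> u \<and> u < v \<and> v \<le> y \<and> \<alpha> u v \<noteq> 0})"
    and b: "(\<forall>x y. \<not> x \<le> y \<longrightarrow> \<beta> x y = 0) \<and>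
      (\<forall>x y. x < y \<longrightarrow> finite {(u, v). x \<le> u \<and> u < v \<and> v \<le> y \<and> \<beta> u v \<noteq> 0})"
  show "\<alpha> x y + \<beta> x y = 0" if "\<not> x \<le> y" using a b that by simp
  show "finite {(u, v). x \<le> u \<and> u < v \<and> v \<le> y \<and> \<alpha> u v + \<beta> u v \<noteq> 0}" if "x < y"
    by (rule finite_subset[of _ "{(u, v). x \<le> u \<and> u < v \<and> v \<le> y \<and> \<alpha> u v \<noteq> 0} \<union>
          {(u, v). x \<le> u \<and> u < v \<and> v \<le> y \<and> \<beta> u v \<noteq> 0}"])
       (use a b that in auto)
qed

definition minus_fi :: "('a, 'b) fi \<Rightarrow> ('a, 'b) fi \<Rightarrow> ('a, 'b) fi" where
  "minus_fi \<alpha> \<beta> = \<alpha> + - \<beta>"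

lift_definition times_fi :: "('a, 'b) fi \<Rightarrow> ('a, 'b) fi \<Rightarrow> ('a, 'b) fi" is conv
proof (intro conjI allI impI)
  fix \<alpha> \<beta> :: "'a \<Rightarrow> 'a \<Rightarrow> 'b" and x y :: 'a
  assume a: "(\<forall>x y. \<not> x \<le> y \<longrightarrow> \<alpha> x y = 0) \<and>
      (\<forall>x y. x < y \<longrightarrow> finite {(u, v). x \<le> u \<and> u < v \<and> v \<le> y \<and> \<alpha> u v \<noteq> 0})"
    and b: "(\<forall>x y. \<not> x \<le> y \<longrightarrow> \<beta> x y = 0) \<and>
      (\<forall>x y. x < y \<longrightarrow> finite {(u, v). x \<le> u \<and> u < v \<and> v \<le> y \<and> \<beta> u v \<noteq> 0})"
  show "conv \<alpha> \<beta> x y = 0" if "\<not> x \<le> y"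
    using that by (metis conv_nonzeroE order.trans)
  let ?F = "endpoints x y \<alpha> \<union> endpoints x y \<beta>"
  have "finite ?F" using a b by (auto intro!: finite_endpoints)
  moreover have "{(u, v). x \<le> u \<and> u < v \<and> v \<le> y \<and> conv \<alpha> \<beta> u v \<noteq> 0} \<subseteq> ?F \<times> ?F"
  proof (intro subsetI, elim CollectE case_prodE, hypsubst, elim conjE)
    fix u v assume uv: "x \<le> u" "u < v" "v \<le> y" "conv \<alpha> \<beta> u v \<noteq> 0"
    from uv(4) obtain z where z: "u \<le> z" "z \<le> v" "\<alpha> u z \<noteq> 0" "\<beta> z v \<noteq> 0"
      by (rule conv_nonzeroE)
    have "u \<in> ?F"
    proof (cases "u = z")
      case True
      then show ?thesis using endpoints_mem[of x u v y \<beta>] uv z by auto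
    next
      case False
      then show ?thesis using endpoints_mem[of x u z y \<alpha>] uv z by auto
    qed
    moreover have "v \<in> ?F"
    proof (cases "v = z")
      case True
      then show ?thesis using endpoints_mem[of x u v y \<alpha>] uv z by auto
    next
      case False
      then show ?thesis using endpoints_mem[of x z v y \<beta>] uv z by auto
    qed
    ultimately show "(u, v) \<in> ?F \<times> ?F" by simp
  qed
  ultimately show "finite {(u, v). x \<le> u \<and> u < v \<and> v \<le> y \<and> conv \<alpha> \<beta> u v \<noteq> 0}"
    by (meson finite_SigmaI finite_subset)
qed

lemma coeff_times_eq_sum:
  fixes \<alpha> \<beta> :: "('a, 'b) fi"
  assumes "finite F"
    and "endpoints p q (coeff \<alpha>) \<subseteq> F \<or> endpoints p q (coeff \<beta>) \<subseteq> F"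
    and "p \<le> x" "y \<le> q" "x \<in> F" "y \<in> F"
  shows "coeff (\<alpha> * \<beta>) x y = (\<Sum>z\<in>F. coeff \<alpha> x z * coeff \<beta> z y)"
  unfolding times_fi.rep_eq
proof (rule conv_eq_sum)
  fix z assume z: "x \<le> z" "z \<le> y" "coeff \<alpha> x z \<noteq> 0" "coeff \<beta> z y \<noteq> 0"
  show "z \<in> F"
  proof (cases "z = x \<or> z = y")
    case False
    then have lt: "x < z" "z < y" using z by auto
    have le: "p \<le> z" "z \<le> q" using z assms(3,4) by (blast intro: order.trans)+
    have "z \<in> endpoints p q (coeff \<alpha>)"
      by (rule endpoints_mem(2)[of p x]) (use lt le z assms(3) in auto)
    moreover have "z \<in> endpoints p q (coeff \<beta>)"
      by (rule endpoints_mem(1)[of p z y]) (use lt le z assms(4) in auto)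
    ultimately show ?thesis using assms(2) by blast
  qed (use assms in auto)
qed (use assms coeff_eq_0 in auto)

instance
proof
  fix a b c :: "('a, 'b) fi"
  show "a + b + c = a + (b + c)" by transfer (simp add: add.assoc)
  show "a + b = b + a" by transfer (simp add: add.commute)
  show "0 + a = a" by transfer simp
  show "- a + a = 0" by transfer simp
  show "a - b = a + - b" by (simp add: minus_fi_def)
  show "(0::('a, 'b) fi) \<noteq> 1" by transfer (metis zero_neq_one)
  have one: "coeff (1::('a, 'b) fi) x y = (if x = y then 1 else 0)" for x y by transfer simp
  show "1 * a = a"
  proof (rule fi_eqI)
    fix x y
    let ?F = "endpoints x y (coeff a)"
    have "coeff (1 * a) x y = (\<Sum>z\<in>?F. coeff 1 x z * coeff a z y)"
      by (rule coeff_times_eq_sum[of _ x y]) (auto simp: finite_endpoints_coeff, auto simp: endpoints_def)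
    also have "\<dots> = (\<Sum>z\<in>?F. if x = z then coeff a z y else 0)"
      by (rule sum.cong) (auto simp: one)
    also have "\<dots> = coeff a x y"
      by (subst sum.delta') (auto simp: finite_endpoints_coeff, auto simp: endpoints_def)
    finally show "coeff (1 * a) x y = coeff a x y" .
  qed
  show "a * 1 = a"
  proof (rule fi_eqI)
    fix x y
    let ?F = "endpoints x y (coeff a)"
    have "coeff (a * 1) x y = (\<Sum>z\<in>?F. coeff a x z * coeff 1 z y)"
      by (rule coeff_times_eq_sum[of _ x y]) (auto simp: finite_endpoints_coeff, auto simp: endpoints_def)
    also have "\<dots> = (\<Sum>z\<in>?F. if z = y then coeff a x z else 0)"
      by (rule sum.cong) (auto simp: one)
    also have "\<dots> = coeff a x y"
      by (subst sum.delta) (auto simp: finite_endpoints_coeff, auto simp: endpoints_def)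
    finally show "coeff (a * 1) x y = coeff a x y" .
  qed
  have F: "\<exists>F. finite F \<and> x \<in> F \<and> y \<in> F \<and> endpoints x y (coeff a) \<subseteq> F \<and>
      endpoints x y (coeff b) \<subseteq> F \<and> endpoints x y (coeff c) \<subseteq> F" for x y
    by (rule exI[of _ "endpoints x y (coeff a) \<union> endpoints x y (coeff b) \<union> endpoints x y (coeff c)"])
       (auto simp: finite_endpoints_coeff, auto simp: endpoints_def)
  show "(a + b) * c = a * c + b * c"
  proof (rule fi_eqI)
    fix x y
    from F[of x y] obtain F where F: "finite F" "x \<in> F" "y \<in> F" "endpoints x y (coeff c) \<subseteq> F"
      by blast
    have m: "coeff (d * c) x y = (\<Sum>z\<in>F. coeff d x z * coeff c z y)" for d
      by (rule coeff_times_eq_sum[of _ x y]) (use F in auto)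
    show "coeff ((a + b) * c) x y = coeff (a * c + b * c) x y"
      by (simp add: m plus_fi.rep_eq distrib_right sum.distrib)
  qed
  show "a * (b + c) = a * b + a * c"
  proof (rule fi_eqI)
    fix x y
    from F[of x y] obtain F where F: "finite F" "x \<in> F" "y \<in> F" "endpoints x y (coeff a) \<subseteq> F"
      by blast
    have m: "coeff (a * d) x y = (\<Sum>z\<in>F. coeff a x z * coeff d z y)" for d
      by (rule coeff_times_eq_sum[of _ x y]) (use F in auto)
    show "coeff (a * (b + c)) x y = coeff (a * b + a * c) x y"
      by (simp add: m plus_fi.rep_eq distrib_left sum.distrib)
  qed
  show "a * b * c = a * (b * c)"
  proof (rule fi_eqI)
    fix x y
    from F[of x y] obtain F where F: "finite F" "x \<in> F" "y \<in> F" "endpoints x y (coeff a) \<subseteq> F"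
      "endpoints x y (coeff b) \<subseteq> F" "endpoints x y (coeff c) \<subseteq> F"
      by blast
    have "coeff (a * b * c) x y = (\<Sum>z\<in>F. coeff (a * b) x z * coeff c z y)"
      by (rule coeff_times_eq_sum[of _ x y]) (use F in auto)
    also have "\<dots> = (\<Sum>z\<in>F. (\<Sum>w\<in>F. coeff a x w * coeff b w z) * coeff c z y)"
    proof (rule sum.cong[OF refl])
      fix z assume "z \<in> F"
      show "coeff (a * b) x z * coeff c z y = (\<Sum>w\<in>F. coeff a x w * coeff b w z) * coeff c z y"
      proof (cases "z \<le> y")
        case True
        have "coeff (a * b) x z = (\<Sum>w\<in>F. coeff a x w * coeff b w z)"
          by (rule coeff_times_eq_sum[of _ x y]) (use F True \<open>z \<in> F\<close> in auto)
        then show ?thesis by simp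
      qed (simp add: coeff_eq_0)
    qed
    also have "\<dots> = (\<Sum>w\<in>F. coeff a x w * (\<Sum>z\<in>F. coeff b w z * coeff c z y))"
      unfolding sum_distrib_left sum_distrib_right
      by (subst sum.swap) (simp add: mult.assoc)
    also have "\<dots> = (\<Sum>w\<in>F. coeff a x w * coeff (b * c) w y)"
    proof (rule sum.cong[OF refl])
      fix w assume "w \<in> F"
      show "coeff a x w * (\<Sum>z\<in>F. coeff b w z * coeff c z y) = coeff a x w * coeff (b * c) w y"
      proof (cases "x \<le> w")
        case True
        have "coeff (b * c) w y = (\<Sum>z\<in>F. coeff b w z * coeff c z y)"
          by (rule coeff_times_eq_sum[of _ x y]) (use F True \<open>w \<in> F\<close> in auto)
        then show ?thesis by simp
      qed (simp add: coeff_eq_0)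
    qed
    also have "\<dots> = coeff (a * (b * c)) x y"
      by (rule coeff_times_eq_sum[of _ x y, symmetric]) (use F in auto)
    finally show "coeff (a * b * c) x y = coeff (a * (b * c)) x y" .
  qed
qed

end

lift_definition fi_scale :: "'k::field \<Rightarrow> ('a::order, 'k) fi \<Rightarrow> ('a, 'k) fi"
  is "\<lambda>c \<alpha> x y. c * \<alpha> x y"
proof (intro conjI allI impI)
  fix c :: 'k and \<alpha> :: "'a \<Rightarrow> 'a \<Rightarrow> 'k" and x y :: 'a
  assume a: "(\<forall>x y. \<not> x \<le> y \<longrightarrow> \<alpha> x y = 0) \<and>
      (\<forall>x y. x < y \<longrightarrow> finite {(u, v). x \<le> u \<and> u < v \<and> v \<le> y \<and> \<alpha> u v \<noteq> 0})"
  show "c * \<alpha> x y = 0" if "\<not> x \<le> y" using a that by simp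
  show "finite {(u, v). x \<le> u \<and> u < v \<and> v \<le> y \<and> c * \<alpha> u v \<noteq> 0}" if "x < y"
    by (rule finite_subset[of _ "{(u, v). x \<le> u \<and> u < v \<and> v \<le> y \<and> \<alpha> u v \<noteq> 0}"])
       (use a that in auto)
qed

interpretation fi: vector_space "fi_scale :: 'k::field \<Rightarrow> ('a::order, 'k) fi \<Rightarrow> ('a, 'k) fi"
  by unfold_locales (transfer, simp add: algebra_simps)+

lemma fi_scale_mult:
  "fi_scale c \<alpha> * \<beta> = fi_scale c (\<alpha> * \<beta>)" "\<alpha> * fi_scale c \<beta> = fi_scale c (\<alpha> * \<beta>)"
proof -
  have s: "coeff (fi_scale c \<gamma>) x y = c * coeff \<gamma> x y" for \<gamma> :: "('a, 'b) fi" and x y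
    by transfer simp
  have "coeff (fi_scale c \<alpha> * \<beta>) x y = coeff (fi_scale c (\<alpha> * \<beta>)) x y \<and>
        coeff (\<alpha> * fi_scale c \<beta>) x y = coeff (fi_scale c (\<alpha> * \<beta>)) x y" for x y
  proof -
    let ?F = "endpoints x y (coeff \<alpha>) \<union> endpoints x y (coeff \<beta>)"
    have F: "finite ?F" "x \<in> ?F" "y \<in> ?F"
      by (auto simp: finite_endpoints_coeff, auto simp: endpoints_def)
    have 1: "coeff (\<alpha> * \<gamma>) x y = (\<Sum>z\<in>?F. coeff \<alpha> x z * coeff \<gamma> z y)" for \<gamma>
      by (rule coeff_times_eq_sum[of _ x y]) (use F in auto)
    have 2: "coeff (\<gamma> * \<beta>) x y = (\<Sum>z\<in>?F. coeff \<gamma> x z * coeff \<beta> z y)" for \<gamma>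
      by (rule coeff_times_eq_sum[of _ x y]) (use F in auto)
    show ?thesis
      unfolding s unfolding 1 2 s by (simp add: sum_distrib_left ac_simps)
  qed
  then show "fi_scale c \<alpha> * \<beta> = fi_scale c (\<alpha> * \<beta>)" "\<alpha> * fi_scale c \<beta> = fi_scale c (\<alpha> * \<beta>)"
    by (auto intro: fi_eqI)
qed

definition fi_J :: "('a::order, 'k::field) fi set" where
  "fi_J = {\<alpha>. \<forall>x. coeff \<alpha> x x = 0}"

definition level :: "'k::field \<Rightarrow> ('a::order, 'k) fi \<Rightarrow> 'a set" where
  "level k \<alpha> = {x. coeff \<alpha> x x = k}"

text \<open>\<open>diag_sum B\<close> is \<open>\<Sum>\<^bsub>k\<^esub> k e\<^bsub>B k\<^esub>\<close>. The description is proper only when the sets \<open>B k\<close> are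
  pairwise disjoint; they need not cover \<open>X\<close>.\<close>

lift_definition diag_sum :: "('k::field \<Rightarrow> 'a::order set) \<Rightarrow> ('a, 'k) fi"
  is "\<lambda>B x y. if x = y \<and> (\<exists>k. x \<in> B k) then (THE k. x \<in> B k) else 0"
proof -
  fix B :: "'k \<Rightarrow> 'a set"
  have "{(u, v). x \<le> u \<and> u < v \<and> v \<le> y \<and>
      (if u = v \<and> (\<exists>k. u \<in> B k) then (THE k. u \<in> B k) else 0) \<noteq> 0} = {}" for x y
    by auto
  then have "finite {(u, v). x \<le> u \<and> u < v \<and> v \<le> y \<and>
      (if u = v \<and> (\<exists>k. u \<in> B k) then (THE k. u \<in> B k) else 0) \<noteq> 0}" for x y
    by (simp only: finite.emptyI)
  then show "(\<forall>x y. \<not> x \<le> y \<longrightarrow> (if x = y \<and> (\<exists>k. x \<in> B k) then THE k. x \<in> B k else 0) = 0) \<and>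
    (\<forall>x y. x < y \<longrightarrow> finite {(u, v). x \<le> u \<and> u < v \<and> v \<le> y \<and>
      (if u = v \<and> (\<exists>k. u \<in> B k) then THE k. u \<in> B k else 0) \<noteq> 0})"
    by simp
qed

lemma coeff_diag_sum:
  assumes "\<And>i j. i \<noteq> j \<Longrightarrow> B i \<inter> B j = {}"
  shows "x \<in> B k \<Longrightarrow> coeff (diag_sum B) x x = k"
    and "(\<And>k. x \<notin> B k) \<Longrightarrow> coeff (diag_sum B) x x = 0"
    and "x \<noteq> y \<Longrightarrow> coeff (diag_sum B) x y = 0"
proof -
  assume "x \<in> B k"
  then have "(THE k. x \<in> B k) = k" using assms by (intro the_equality) blast+
  with \<open>x \<in> B k\<close> show "coeff (diag_sum B) x x = k" by (auto simp: diag_sum.rep_eq)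
qed (auto simp: diag_sum.rep_eq)

section \<open>Invertibility preservers\<close>

definition ring_units :: "'r::ring_1 set" where
  "ring_units = {a. \<exists>b. a * b = 1 \<and> b * a = 1}"

definition invertibility_preserver :: "('r::ring_1 \<Rightarrow> 'r) \<Rightarrow> bool" where
  "invertibility_preserver \<phi> \<longleftrightarrow> \<phi> ` ring_units \<subseteq> ring_units"

definition unital :: "('r::ring_1 \<Rightarrow> 'r) \<Rightarrow> bool" where
  "unital \<phi> \<longleftrightarrow> \<phi> 1 = 1"

definition strong_invertibility_preserver :: "('r::ring_1 \<Rightarrow> 'r) \<Rightarrow> bool" where
  "strong_invertibility_preserver \<phi> \<longleftrightarrow>
     invertibility_preserver \<phi> \<and> (\<forall>a. a \<in> ring_units \<longleftrightarrow> \<phi> a \<in> ring_units)"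

section \<open>Endomorphisms of the Boolean algebra of subsets\<close>

definition powerset_endo :: "('a set \<Rightarrow> 'a set) \<Rightarrow> bool" where
  "powerset_endo l \<longleftrightarrow>
     (\<forall>A B. l (A \<union> B) = l A \<union> l B) \<and> (\<forall>A B. l (A \<inter> B) = l A \<inter> l B) \<and>
     (\<forall>A. l (- A) = - l A) \<and> l {} = {} \<and> l UNIV = UNIV"

definition powerset_auto :: "('a set \<Rightarrow> 'a set) \<Rightarrow> bool" where
  "powerset_auto l \<longleftrightarrow> powerset_endo l \<and> bij l"

unbundle cardinal_syntax

text \<open>A cardinal \<open>\<kappa>\<close> is given as a (cardinal) well-order relation. Completeness is stated for sets
  \<open>\<A>\<close> of subsets, because a definition cannot quantify over the type of an index set;
  \<open>kappa_complete_family\<close> is the form for indexed families.\<close>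

definition kappa_complete :: "'c rel \<Rightarrow> ('a set \<Rightarrow> 'a set) \<Rightarrow> bool" where
  "kappa_complete \<kappa> l \<longleftrightarrow> (\<forall>\<A>. |\<A>| \<le>o \<kappa> \<longrightarrow> l (\<Union>\<A>) = (\<Union>A\<in>\<A>. l A))"

lemma kappa_complete_family:
  assumes "kappa_complete \<kappa> l" "|I| \<le>o \<kappa>"
  shows "l (\<Union>i\<in>I. A i) = (\<Union>i\<in>I. l (A i))"
proof -
  have "|A ` I| \<le>o \<kappa>" using card_of_image ordLeq_transitive assms(2) by blast
  with assms(1) have "l (\<Union>(A ` I)) = (\<Union>B\<in>A ` I. l B)" unfolding kappa_complete_def by blast
  then show ?thesis by simp
qed

end

theory Submission
  imports Defs
begin

text \<open>An element of \<open>FI(X, K)\<close> is a unit iff its diagonal has no zero: after scaling the diagonal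
  to \<open>1\<close> it has the form \<open>1 - \<nu>\<close> with \<open>\<nu> \<in> J\<close>, and the powers of \<open>\<nu>\<close> eventually vanish on every
  interval, so the geometric series converges coefficientwise. On the other hand
  \<open>L\<^sub>k(\<phi>(\<alpha>)) = \<lambda>(L\<^sub>k(\<alpha>))\<close> by completeness of \<open>\<lambda>\<close>, so \<open>\<phi>\<close> is strong iff \<open>\<lambda>\<close> has trivial kernel,
  and the remaining equivalences are read off the level sets.\<close>

section \<open>Coefficients of sums and products\<close>

lemma coeff_simps [simp]:
  "coeff 0 x y = 0"
  "coeff 1 x y = (if x = y then 1 else 0)"
  "coeff (\<alpha> + \<beta>) x y = coeff \<alpha> x y + coeff \<beta> x y"
  "coeff (- \<alpha>) x y = - coeff \<alpha> x y"
  by (transfer, simp)+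

lemma coeff_minus [simp]: "coeff (\<alpha> - \<beta>) x y = coeff \<alpha> x y - coeff \<beta> x y"
  unfolding minus_fi_def coeff_simps by simp

lemma coeff_sum: "coeff (sum f A) x y = (\<Sum>i\<in>A. coeff (f i) x y)"
  by (induction A rule: infinite_finite_induct) auto

lemma coeff_times_diag: "coeff (\<alpha> * \<beta>) x x = coeff \<alpha> x x * coeff \<beta> x x"
proof -
  have "conv (coeff \<alpha>) (coeff \<beta>) x x = (\<Sum>z\<in>{x}. coeff \<alpha> x z * coeff \<beta> z x)"
    by (rule conv_eq_sum) (auto simp: coeff_eq_0)
  then show ?thesis by (simp add: times_fi.rep_eq)
qed

lemma coeff_times_nonzeroE:
  assumes "coeff (\<alpha> * \<beta>) x y \<noteq> 0"
  obtains z where "coeff \<alpha> x z \<noteq> 0" "coeff \<beta> z y \<noteq> 0"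
  using assms conv_nonzeroE by (metis times_fi.rep_eq)

text \<open>Only entries between \<open>x\<close> and \<open>y\<close> enter the product at
  \<open>(x, y)\<close>. This allows a coefficientwise limit to be replaced by a partial sum inside
  a product.\<close>

lemma coeff_times_cong:
  assumes "\<And>u v. x \<le> u \<Longrightarrow> v \<le> y \<Longrightarrow> coeff \<alpha> u v = coeff \<alpha>' u v"
    and "\<And>u v. x \<le> u \<Longrightarrow> v \<le> y \<Longrightarrow> coeff \<beta> u v = coeff \<beta>' u v"
  shows "coeff (\<alpha> * \<beta>) x y = coeff (\<alpha>' * \<beta>') x y"
  unfolding times_fi.rep_eq conv_def using assms by (intro sum.cong) auto

section \<open>Units\<close>

lemma ring_units_mult: "a \<in> ring_units \<Longrightarrow> b \<in> ring_units \<Longrightarrow> a * b \<in> ring_units"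
  unfolding ring_units_def by (clarsimp, metis mult.assoc mult_1_left)

text \<open>A nonzero coefficient of \<open>\<nu> ^ k\<close> at \<open>(u, v)\<close> yields a
  chain of \<open>k\<close> links from \<open>u\<close> to \<open>v\<close> with
  \<open>\<nu>\<close> nonzero on each link. The links are strict since \<nu> has zero diagonal, so
  the \<open>k\<close> points after \<open>u\<close> are distinct elements of the finite set
  \<open>endpoints x y (coeff \<nu>)\<close>.\<close>

lemma coeff_power_nonzero_le_card:
  assumes "\<nu> \<in> fi_J" "coeff (\<nu> ^ k) u v \<noteq> 0" "x \<le> u" "v \<le> y"
  shows "k \<le> card {w \<in> endpoints x y (coeff \<nu>). u < w}"
  using assms(2,3)
proof (induction k arbitrary: u)
  case (Suc k)
  let ?F = "endpoints x y (coeff \<nu>)"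
  from Suc.prems(1) obtain z where z: "coeff \<nu> u z \<noteq> 0" "coeff (\<nu> ^ k) z v \<noteq> 0"
    by (auto elim: coeff_times_nonzeroE)
  have "u \<le> z" "z \<le> v" using z coeff_eq_0 by blast+
  moreover have "u \<noteq> z" using z(1) assms(1) by (auto simp: fi_J_def)
  ultimately have uz: "u < z" "x \<le> z" "z \<le> y"
    using Suc.prems(2) assms(4) by (auto intro: order.trans)
  have "z \<in> ?F" using endpoints_mem(2)[of x u z y] uz Suc.prems(2) z(1) by blast
  then have "{w \<in> ?F. z < w} \<subset> {w \<in> ?F. u < w}" using uz by auto
  then have "card {w \<in> ?F. z < w} < card {w \<in> ?F. u < w}"
    by (intro psubset_card_mono) (auto simp: finite_endpoints_coeff)
  moreover have "k \<le> card {w \<in> ?F. z < w}" using Suc.IH z(2) uz(2) by blast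
  ultimately show ?case by simp
qed simp

lemma locally_nilpotent:
  assumes "\<nu> \<in> fi_J"
  obtains N where "\<And>k u v. N \<le> k \<Longrightarrow> x \<le> u \<Longrightarrow> v \<le> y \<Longrightarrow> coeff (\<nu> ^ k) u v = 0"
proof
  fix k u v
  let ?F = "endpoints x y (coeff \<nu>)"
  \<comment> \<open>This choice of \<open>N\<close> depends on \<open>x\<close> and \<open>y\<close>
    only, so it serves all \<open>u\<close>, \<open>v\<close> inside the interval at once.\<close>
  assume k: "Suc (card ?F) \<le> k" and uv: "x \<le> u" "v \<le> y"
  have "card {w \<in> ?F. u < w} \<le> card ?F"
    by (intro card_mono) (auto simp: finite_endpoints_coeff)
  with coeff_power_nonzero_le_card[OF assms _ uv, of k] k
  show "coeff (\<nu> ^ k) u v = 0" by linarith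
qed

lemma one_minus_in_ring_units:
  fixes \<nu> :: "('a::order, 'k::field) fi"
  assumes "\<nu> \<in> fi_J"
  shows "1 - \<nu> \<in> ring_units"
proof -
  have "\<exists>N. \<forall>x y k u v. N x y \<le> k \<longrightarrow> x \<le> u \<longrightarrow> v \<le> y \<longrightarrow> coeff (\<nu> ^ k) u v = 0"
    by (metis locally_nilpotent[OF assms])
  then obtain N where N: "\<And>x y k u v. N x y \<le> k \<Longrightarrow> x \<le> u \<Longrightarrow> v \<le> y \<Longrightarrow> coeff (\<nu> ^ k) u v = 0"
    by blast
  define S where "S n = (\<Sum>k<n. \<nu> ^ k)" for n
  \<comment> \<open>The limit of the geometric series: each entry is read from the partial sum that
    is already stable on \<open>[u, v]\<close>.\<close>
  define b where "b u v = coeff (S (N u v)) u v" for u v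
  have S_stable: "coeff (S n) u v = coeff (S m) u v"
    if "N x y \<le> n" "n \<le> m" "x \<le> u" "v \<le> y" for n m x y u v
  proof -
    have "(\<Sum>k<n. coeff (\<nu> ^ k) u v) = (\<Sum>k<m. coeff (\<nu> ^ k) u v)"
      by (rule sum.mono_neutral_left) (use that N[of x y _ u v] in auto)
    then show ?thesis by (simp add: S_def coeff_sum)
  qed
  \<comment> \<open>On \<open>[x, y]\<close> the limit agrees with one single partial sum, which
    gives both the finiteness condition and the products below. No monotonicity of \<open>N\<close>
    is known, so the two bounds are compared through their maximum.\<close>
  have b_eq: "b u v = coeff (S (N x y)) u v" if "x \<le> u" "v \<le> y" for x y u v
    using S_stable[of u v "N u v" "max (N u v) (N x y)" u v]
      S_stable[of x y "N x y" "max (N u v) (N x y)" u v] that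
    by (simp add: b_def)
  have "b \<in> {\<alpha>. (\<forall>x y. \<not> x \<le> y \<longrightarrow> \<alpha> x y = 0) \<and>
      (\<forall>x y. x < y \<longrightarrow> finite {(u, v). x \<le> u \<and> u < v \<and> v \<le> y \<and> \<alpha> u v \<noteq> 0})}"
  proof (intro CollectI conjI allI impI)
    fix x y :: 'a
    show "b x y = 0" if "\<not> x \<le> y" using that by (simp add: b_def coeff_eq_0)
    assume "x < y"
    then have "finite {(u, v). x \<le> u \<and> u < v \<and> v \<le> y \<and> coeff (S (N x y)) u v \<noteq> 0}"
      using coeff[of "S (N x y)"] by simp
    then show "finite {(u, v). x \<le> u \<and> u < v \<and> v \<le> y \<and> b u v \<noteq> 0}"
      by (rule rev_finite_subset) (auto simp: b_eq)
  qed
  then obtain \<beta> where \<beta>: "coeff \<beta> = b" using Abs_fi_inverse by blast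
  have geometric: "(1 - \<nu>) * S n = 1 - \<nu> ^ n" "S n * (1 - \<nu>) = 1 - \<nu> ^ n" for n
    by (induction n) (simp_all add: S_def distrib_left distrib_right,
       simp_all add: algebra_simps power_commutes)
  have "coeff ((1 - \<nu>) * \<beta>) x y = coeff 1 x y" for x y
  proof -
    have "coeff ((1 - \<nu>) * \<beta>) x y = coeff ((1 - \<nu>) * S (N x y)) x y"
      by (rule coeff_times_cong) (simp_all add: \<beta> b_eq)
    then show ?thesis using N[of x y "N x y" x y] by (simp add: geometric)
  qed
  moreover have "coeff (\<beta> * (1 - \<nu>)) x y = coeff 1 x y" for x y
  proof -
    have "coeff (\<beta> * (1 - \<nu>)) x y = coeff (S (N x y) * (1 - \<nu>)) x y"
      by (rule coeff_times_cong) (simp_all add: \<beta> b_eq)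
    then show ?thesis using N[of x y "N x y" x y] by (simp add: geometric)
  qed
  ultimately show ?thesis unfolding ring_units_def by (blast intro: fi_eqI)
qed

text \<open>The fibres of \<open>f\<close> are disjoint and cover the poset, so
  \<open>diag_sum\<close> returns exactly \<open>f x\<close> at each point.\<close>

definition diagonal :: "('a \<Rightarrow> 'k) \<Rightarrow> ('a::order, 'k::field) fi" where
  "diagonal f = diag_sum (\<lambda>k. {x. f x = k})"

lemma coeff_diagonal: "coeff (diagonal f) x y = (if x = y then f x else 0)"
  using coeff_diag_sum(1)[of "\<lambda>k. {x. f x = k}" x "f x"]
    coeff_diag_sum(3)[of "\<lambda>k. {x. f x = k}" x y] by (auto simp: diagonal_def)

lemma diagonal_mult: "diagonal f * diagonal g = diagonal (\<lambda>x. f x * g x)"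
proof (rule fi_eqI)
  fix x y
  show "coeff (diagonal f * diagonal g) x y = coeff (diagonal (\<lambda>x. f x * g x)) x y"
  proof (cases "x = y")
    case True
    then show ?thesis by (simp add: coeff_times_diag coeff_diagonal)
  next
    case False
    then have "coeff (diagonal f * diagonal g) x y = 0"
      by (metis coeff_diagonal coeff_times_nonzeroE)
    then show ?thesis using False by (simp add: coeff_diagonal)
  qed
qed

lemma diagonal_1: "diagonal (\<lambda>_. 1) = 1"
  by (rule fi_eqI) (simp add: coeff_diagonal)

text \<open>Turns statements about zero levels of elements into statements about arbitrary
  subsets.\<close>

lemma ex_level_0: "\<exists>\<alpha> :: ('a::order, 'k::field) fi. level 0 \<alpha> = A"
proof
  show "level 0 (diagonal (\<lambda>x. if x \<in> A then 0 else 1)) = A"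
    by (auto simp: level_def coeff_diagonal)
qed

lemma ring_units_iff_level:
  fixes \<alpha> :: "('a::order, 'k::field) fi"
  shows "\<alpha> \<in> ring_units \<longleftrightarrow> level 0 \<alpha> = {}"
proof
  assume "\<alpha> \<in> ring_units"
  then obtain \<beta> where "\<alpha> * \<beta> = 1" unfolding ring_units_def by blast
  then have "coeff \<alpha> x x * coeff \<beta> x x = 1" for x
    by (metis coeff_times_diag coeff_simps(2))
  then have "coeff \<alpha> x x \<noteq> 0" for x by (metis mult_zero_left zero_neq_one)
  then show "level 0 \<alpha> = {}" by (simp add: level_def)
next
  assume "level 0 \<alpha> = {}"
  then have nz: "coeff \<alpha> x x \<noteq> 0" for x by (auto simp: level_def)
  let ?d = "diagonal (\<lambda>x. coeff \<alpha> x x)" and ?e = "diagonal (\<lambda>x. inverse (coeff \<alpha> x x))"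
  have de: "?d * ?e = 1" "?e * ?d = 1" using nz by (simp_all add: diagonal_mult diagonal_1)
  \<comment> \<open>\<open>?e * \<alpha>\<close> has diagonal 1, so it is 1 minus an element of
    \<open>fi_J\<close>; multiplying by \<open>?d\<close> recovers \<alpha>.\<close>
  have "1 - ?e * \<alpha> \<in> fi_J" using nz by (simp add: fi_J_def coeff_times_diag coeff_diagonal)
  from one_minus_in_ring_units[OF this] have "?e * \<alpha> \<in> ring_units" by simp
  moreover have "?d \<in> ring_units" using de by (auto simp: ring_units_def)
  ultimately have "?d * (?e * \<alpha>) \<in> ring_units" by (rule ring_units_mult[rotated])
  then show "\<alpha> \<in> ring_units" by (simp add: de flip: mult.assoc)
qed

section \<open>Level sets\<close>

lemma level_disjoint: "i \<noteq> j \<Longrightarrow> level i \<alpha> \<inter> level j \<alpha> = {}"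
  by (auto simp: level_def)

lemma Union_level: "(\<Union>k. level k \<alpha>) = UNIV"
  by (auto simp: level_def)

lemma fi_J_iff_level: "\<alpha> \<in> fi_J \<longleftrightarrow> level 0 \<alpha> = UNIV"
  by (auto simp: fi_J_def level_def)

lemma level_add_fi_J: "\<beta> \<in> fi_J \<Longrightarrow> level k (\<alpha> + \<beta>) = level k \<alpha>"
  by (simp add: fi_J_def level_def)

lemma diff_in_fi_J:
  assumes "\<And>k. level k \<alpha> = level k \<beta>"
  shows "\<alpha> - \<beta> \<in> fi_J"
  using assms by (auto simp: fi_J_def level_def set_eq_iff)

section \<open>Boolean endomorphisms and their action on level sets\<close>

lemma powerset_endo_diff:
  assumes "powerset_endo l"
  shows "l (A - B) = l A - l B"
  using assms unfolding powerset_endo_def by (simp add: Diff_eq)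

text \<open>If \<open>l A = l B\<close>, then \<open>l\<close> sends \<open>A - B\<close> and
  \<open>B - A\<close> to the empty set, so a trivial kernel forces \<open>A = B\<close>.\<close>

lemma powerset_endo_inj_iff:
  assumes "powerset_endo l"
  shows "inj l \<longleftrightarrow> (\<forall>A. l A = {} \<longrightarrow> A = {})"
proof
  show "inj l \<Longrightarrow> \<forall>A. l A = {} \<longrightarrow> A = {}"
    using assms by (metis injD powerset_endo_def)
  assume "\<forall>A. l A = {} \<longrightarrow> A = {}"
  then show "inj l"
    by (intro injI) (metis Diff_cancel Diff_eq_empty_iff powerset_endo_diff[OF assms] subset_antisym)
qed

lemma kappa_complete_UN:
  fixes A :: "'k \<Rightarrow> 'a set"
  assumes "kappa_complete (card_of (UNIV :: 'k set)) l"
  shows "l (\<Union>k. A k) = (\<Union>k. l (A k))"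
  by (rule kappa_complete_family[OF assms]) (simp add: card_of_mono1)

text \<open>Covering matters for \<open>k = 0\<close>: \<open>diag_sum\<close> takes the default
  value 0 at points outside every block.\<close>

lemma level_diag_sum:
  assumes "\<And>i j. i \<noteq> j \<Longrightarrow> B i \<inter> B j = {}" "(\<Union>k. B k) = UNIV"
  shows "level k (diag_sum B) = B k"
proof -
  have "coeff (diag_sum B) x x = k \<longleftrightarrow> x \<in> B k" for x
  proof -
    obtain j where "x \<in> B j" using assms(2) by blast
    then show ?thesis using coeff_diag_sum(1)[of B x] assms(1) by fast
  qed
  then show ?thesis by (auto simp: level_def)
qed

text \<open>The level sets partition the poset. Disjointness of their images is Boolean; that the
  images still cover is where completeness enters.\<close>

lemma level_diag_sum_endo:
  fixes \<alpha> :: "('a::order, 'k::field) fi"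
  assumes "powerset_endo l" "kappa_complete (card_of (UNIV :: 'k set)) l"
  shows "level k (diag_sum (\<lambda>k. l (level k \<alpha>))) = l (level k \<alpha>)"
proof (rule level_diag_sum)
  show "l (level i \<alpha>) \<inter> l (level j \<alpha>) = {}" if "i \<noteq> j" for i j
    using assms(1) level_disjoint[OF that, of \<alpha>] unfolding powerset_endo_def by metis
  show "(\<Union>k. l (level k \<alpha>)) = UNIV"
    using kappa_complete_UN[OF assms(2), of "\<lambda>k. level k \<alpha>"] assms(1)
    by (simp add: Union_level powerset_endo_def)
qed

theorem mainTheorem4:
  fixes lam :: "'a::order set \<Rightarrow> 'a set"
    and \<psi> \<phi> :: "('a, 'k::field) fi \<Rightarrow> ('a, 'k) fi"
  assumes card_K: "infinite (UNIV :: 'k set) \<or> card (UNIV :: 'k set) > 2"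
    and lam_endo: "powerset_endo lam"
    and lam_complete: "kappa_complete (card_of (UNIV :: 'k set)) lam"
    and psi_linear: "Vector_Spaces.linear fi_scale fi_scale \<psi>"
    and psi_range: "range \<psi> \<subseteq> fi_J"
    and psi_delta: "\<psi> 1 = 0"
    and phi_unital: "unital \<phi>"
    and phi_linear: "Vector_Spaces.linear fi_scale fi_scale \<phi>"
    and phi_preserver: "invertibility_preserver \<phi>"
    and phi_def: "\<And>\<alpha>. \<phi> \<alpha> = diag_sum (\<lambda>k. lam (level k \<alpha>)) + \<psi> \<alpha>"
  shows "surj \<phi> \<and> strong_invertibility_preserver \<phi> \<longleftrightarrow> powerset_auto lam \<and> \<psi> ` fi_J = fi_J"
proof -
  interpret \<phi>: Vector_Spaces.linear fi_scale fi_scale \<phi> by (rule phi_linear)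
  have lam_simps: "lam {} = {}" "lam UNIV = UNIV" "lam (A \<inter> B) = lam A \<inter> lam B"
    for A B using lam_endo unfolding powerset_endo_def by auto
  have psi_J: "\<psi> \<alpha> \<in> fi_J" for \<alpha> using psi_range by auto
  have level_phi: "level k (\<phi> \<alpha>) = lam (level k \<alpha>)" for k \<alpha>
    by (simp add: phi_def level_add_fi_J psi_J level_diag_sum_endo lam_endo lam_complete)
  \<comment> \<open>For \<alpha> in \<open>fi_J\<close> the zero level is everything and
    \<open>lam\<close> preserves it, so the diagonal part of \<open>\<phi> \<alpha>\<close>
    vanishes.\<close>
  have phi_J: "\<phi> \<alpha> = \<psi> \<alpha>" if "\<alpha> \<in> fi_J" for \<alpha>
  proof -
    have "diag_sum (\<lambda>k. lam (level k \<alpha>)) \<in> fi_J"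
      using that by (simp add: level_diag_sum_endo lam_endo lam_complete fi_J_iff_level lam_simps)
    then have "coeff (diag_sum (\<lambda>k. lam (level k \<alpha>))) x y = 0" for x y
      by (cases "x = y") (simp add: fi_J_def, simp add: diag_sum.rep_eq)
    then show ?thesis by (simp add: phi_def fi_eqI)
  qed
  have strong_iff: "strong_invertibility_preserver \<phi> \<longleftrightarrow> inj lam"
  proof -
    have "strong_invertibility_preserver \<phi> \<longleftrightarrow>
        (\<forall>\<alpha> :: ('a, 'k) fi. level 0 \<alpha> = {} \<longleftrightarrow> lam (level 0 \<alpha>) = {})"
      by (simp add: strong_invertibility_preserver_def phi_preserver ring_units_iff_level level_phi)
    also have "\<dots> \<longleftrightarrow> (\<forall>A. A = {} \<longleftrightarrow> lam A = {})"
    proof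
      assume L: "\<forall>\<alpha> :: ('a, 'k) fi. level 0 \<alpha> = {} \<longleftrightarrow> lam (level 0 \<alpha>) = {}"
      show "\<forall>A. A = {} \<longleftrightarrow> lam A = {}"
      proof
        fix A
        obtain \<alpha> :: "('a, 'k) fi" where "level 0 \<alpha> = A" using ex_level_0 by blast
        then show "A = {} \<longleftrightarrow> lam A = {}" using L[rule_format, of \<alpha>] by simp
      qed
    next
      assume "\<forall>A. A = {} \<longleftrightarrow> lam A = {}"
      then show "\<forall>\<alpha> :: ('a, 'k) fi. level 0 \<alpha> = {} \<longleftrightarrow> lam (level 0 \<alpha>) = {}"
        by (intro allI) (erule spec)
    qed
    also have "\<dots> \<longleftrightarrow> inj lam"
      using lam_simps(1) by (auto simp: powerset_endo_inj_iff[OF lam_endo])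
    finally show ?thesis .
  qed
  show ?thesis
  proof
    assume strong_surj: "surj \<phi> \<and> strong_invertibility_preserver \<phi>"
    then have inj: "inj lam" and surj: "surj \<phi>" using strong_iff by auto
    \<comment> \<open>Realize \<open>B\<close> as the zero level of some element; the zero level of
      a preimage under \<phi> is then mapped to \<open>B\<close> by \<open>lam\<close>.\<close>
    have "B \<in> range lam" for B
      using surj level_phi ex_level_0 by (metis rangeI surjD)
    moreover have "\<beta> \<in> \<psi> ` fi_J" if "\<beta> \<in> fi_J" for \<beta>
    proof -
      obtain \<alpha> where \<alpha>: "\<beta> = \<phi> \<alpha>" using surj by blast
      then have "lam (level 0 \<alpha>) = lam UNIV"
        using that level_phi by (metis fi_J_iff_level lam_simps(2))
      then have "\<alpha> \<in> fi_J" using inj by (simp add: inj_eq fi_J_iff_level)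
      then show ?thesis using \<alpha> phi_J by auto
    qed
    ultimately show "powerset_auto lam \<and> \<psi> ` fi_J = fi_J"
      using inj lam_endo psi_J by (auto simp: powerset_auto_def bij_def)
  next
    assume R: "powerset_auto lam \<and> \<psi> ` fi_J = fi_J"
    then have bij: "bij lam" by (simp add: powerset_auto_def)
    have "\<beta> \<in> range \<phi>" for \<beta>
    proof -
      \<comment> \<open>Pull the levels of \<beta> back along \<open>lam\<close>. By injectivity
        they again form a partition, so \<open>diag_sum A\<close> has them as its levels.\<close>
      define A where "A k = inv lam (level k \<beta>)" for k
      have lam_A: "lam (A k) = level k \<beta>" for k
        unfolding A_def using bij by (simp add: bij_is_surj surj_f_inv_f)
      have "A i \<inter> A j = {}" if "i \<noteq> j" for i j
      proof -
        have "lam (A i \<inter> A j) = lam {}" by (simp add: lam_simps lam_A level_disjoint that)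
        then show ?thesis using bij by (simp only: bij_is_inj inj_eq)
      qed
      moreover have "(\<Union>k. A k) = UNIV"
      proof -
        have "lam (\<Union>k. A k) = lam UNIV"
          by (simp add: kappa_complete_UN[OF lam_complete] lam_A Union_level lam_simps)
        then show ?thesis using bij by (simp only: bij_is_inj inj_eq)
      qed
      ultimately have "level k (diag_sum A) = A k" for k by (rule level_diag_sum)
      \<comment> \<open>The image of \<open>diag_sum A\<close> has the diagonal of \<beta>. The
        remaining error lies in \<open>fi_J\<close>, hence is
        \<open>\<psi> \<gamma> = \<phi> \<gamma>\<close> for some \<gamma> in \<open>fi_J\<close>,
        and linearity removes it.\<close>
      then have "\<phi> (diag_sum A) - \<beta> \<in> fi_J"
        by (intro diff_in_fi_J) (simp add: level_phi lam_A)
      then obtain \<gamma> where "\<gamma> \<in> fi_J" "\<psi> \<gamma> = \<phi> (diag_sum A) - \<beta>" using R by (metis imageE)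
      then have "\<phi> (diag_sum A - \<gamma>) = \<beta>" by (simp add: \<phi>.diff phi_J)
      then show ?thesis by blast
    qed
    then show "surj \<phi> \<and> strong_invertibility_preserver \<phi>"
      using strong_iff bij by (auto simp: bij_is_inj)
  qed
qed

end
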